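(* Let $k\in\mathbb{N}$, and assume the following quadratic density Hales-Jewett statement for $k$ letters: for every $\delta>0$ there exists $Q(\delta)$ such that for all $n\ge Q(\delta)$, every subset $A\subset\{1,\dots,k\}^{n^2}$ with $|A|\ge\delta k^{n^2}$ contains a combinatorial line whose wildcard set is of the form $\gamma\times\gamma$ with $\gamma\subset\{1,\dots,n\}$ nonempty. Then for every $\epsilon>0$ and every positive integer $d$ there exists $N=N(\epsilon,k,d)$ having the property that if $E\subset\{1,\dots,k\}^{N^2}$ with $|E|\ge\epsilon k^{N^2}$, then there exists a $d$-dimensional combinatorial subspace contained in $E$, of cardinality $k^d$, where each of the $d$ wildcard sets is of the form $\alpha_i\times\alpha_i$, and the sets $\alpha_i\subset\{1,2,\dots,N\}$, $1\le i\le d$, are distinct.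
   Context: Elements of $\{1,\dots,k\}^{n^2}$ are words indexed by the grid $\{1,\dots,n\}\times\{1,\dots,n\}$. For a word $a$, a set $\Gamma$ of grid points and a letter $x\in\{1,\dots,k\}$, $a\oplus x\Gamma$ denotes the word obtained from $a$ by replacing every entry at a point of $\Gamma$ by $x$ and leaving the other entries unchanged. A combinatorial line with wildcard set $\Gamma$ is a set $\{a\oplus x\Gamma: 1\le x\le k\}$. A $d$-dimensional combinatorial subspace with wildcard sets $\Gamma_1,\dots,\Gamma_d$ is a set $\{a\oplus x_1\Gamma_1\oplus x_2\Gamma_2\oplus\dots\oplus x_d\Gamma_d : 1\le x_i\le k \text{ for all } 1\le i\le d\}$. *)

theory Defs
  imports Complex_Main "HOL-Library.FuncSet"
begin

definition grid :: "nat \<Rightarrow> (nat \<times> nat) set" where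
  "grid n = {1..n} \<times> {1..n}"

text \<open>Words over the alphabet \<open>{1..k}\<close> indexed by the \<open>n \<times> n\<close> grid; being extensional
  functions, they form a finite set of cardinality \<open>k ^ n\<^sup>2\<close>.\<close>

definition grid_words :: "nat \<Rightarrow> nat \<Rightarrow> (nat \<times> nat \<Rightarrow> nat) set" where
  "grid_words k n = (grid n \<rightarrow>\<^sub>E {1..k})"

definition put_letter ::
    "(nat \<times> nat \<Rightarrow> nat) \<Rightarrow> nat \<Rightarrow> (nat \<times> nat) set \<Rightarrow> (nat \<times> nat \<Rightarrow> nat)" where
  "put_letter a x \<Gamma> = override_on a (\<lambda>_. x) \<Gamma>"

text \<open>The left-to-right iteration \<open>a \<oplus> x 1 (\<Gamma> 1) \<oplus> \<dots> \<oplus> x d (\<Gamma> d)\<close>. The sets may overlap, in which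
  case later letters overwrite earlier ones.\<close>

primrec put_letters ::
    "(nat \<times> nat \<Rightarrow> nat) \<Rightarrow> (nat \<Rightarrow> nat) \<Rightarrow> (nat \<Rightarrow> (nat \<times> nat) set) \<Rightarrow> nat \<Rightarrow> (nat \<times> nat \<Rightarrow> nat)" where
  "put_letters a x \<Gamma> 0 = a"
| "put_letters a x \<Gamma> (Suc d) = put_letter (put_letters a x \<Gamma> d) (x (Suc d)) (\<Gamma> (Suc d))"

definition is_comb_line ::
    "nat \<Rightarrow> nat \<Rightarrow> (nat \<times> nat) set \<Rightarrow> (nat \<times> nat \<Rightarrow> nat) set \<Rightarrow> bool" where
  "is_comb_line k n \<Gamma> L \<longleftrightarrow> \<Gamma> \<subseteq> grid n \<and>
     (\<exists>a \<in> grid_words k n. L = {put_letter a x \<Gamma> | x. x \<in> {1..k}})"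

text \<open>Following the source convention, the wildcard sets \<open>\<Gamma> 1, \<dots>, \<Gamma> d\<close> are not required to be
  disjoint or nonempty, so the cardinality of a \<open>d\<close>-dimensional subspace may be less than \<open>k ^ d\<close>.\<close>

definition is_comb_subspace ::
    "nat \<Rightarrow> nat \<Rightarrow> nat \<Rightarrow> (nat \<Rightarrow> (nat \<times> nat) set) \<Rightarrow> (nat \<times> nat \<Rightarrow> nat) set \<Rightarrow> bool" where
  "is_comb_subspace k n d \<Gamma> S \<longleftrightarrow> (\<forall>i\<in>{1..d}. \<Gamma> i \<subseteq> grid n) \<and>
     (\<exists>a \<in> grid_words k n. S = {put_letters a x \<Gamma> d | x. \<forall>i\<in>{1..d}. x i \<in> {1..k}})"

end

theory Submission imports Defs begin

text \<open>
  The dimension is raised by one at a time. Suppose that dense sets of words on the grid of side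
  \<open>M\<close> contain \<open>d\<close>-dimensional subspaces of the required kind. The grid of side \<open>M + m\<close> consists of
  the two diagonal blocks \<open>{1..M}\<^sup>2\<close> and \<open>{M+1..M+m}\<^sup>2\<close> and of a cross part that belongs to neither.
  By averaging, the letters on the cross part can be fixed without loss of density
  (\<open>dense_join_section\<close>), so that a word becomes a pair \<open>(u, v)\<close> of words on the two blocks.

  For a positive proportion of the \<open>v\<close>, the words \<open>u\<close> that are admissible with \<open>v\<close> are still dense,
  hence contain a \<open>d\<close>-dimensional subspace. As \<open>M\<close> does not depend on \<open>m\<close>, there is a bounded number
  of subspaces, and some single subspace \<open>S\<close> works for a set of \<open>v\<close> whose density is bounded below
  independently of \<open>m\<close> (\<open>dense_common_subset\<close>). If \<open>m\<close> is large enough, the quadratic density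
  Hales-Jewett property yields a line of such \<open>v\<close> with wildcard set \<open>\<gamma> \<times> \<gamma>\<close>. The product of \<open>S\<close>
  with this line is a subspace of dimension \<open>d + 1\<close> (\<open>comb_subspace_join_line\<close>). The new wildcard set
  is the square of the translate of \<open>\<gamma>\<close> by \<open>M\<close>. This translate is nonempty and disjoint from
  \<open>{1..M}\<close>, hence differs from the earlier \<open>\<alpha> i\<close>, and its square lies outside the first block, so
  the cardinality gets multiplied by \<open>k\<close>.
\<close>

section \<open>Words on a grid composed of two diagonal blocks\<close>

definition shift_block :: "nat \<Rightarrow> nat \<Rightarrow> (nat \<times> nat) set" where
  "shift_block M m = {M+1..M+m} \<times> {M+1..M+m}"

definition cross_part :: "nat \<Rightarrow> nat \<Rightarrow> (nat \<times> nat) set" where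
  "cross_part M m = grid (M + m) - grid M - shift_block M m"

definition join_words ::
    "nat \<Rightarrow> nat \<Rightarrow> (nat \<times> nat \<Rightarrow> nat) \<Rightarrow> (nat \<times> nat \<Rightarrow> nat) \<Rightarrow> (nat \<times> nat \<Rightarrow> nat) \<Rightarrow> (nat \<times> nat \<Rightarrow> nat)"
where
  "join_words M m c u v = (\<lambda>p. if p \<in> grid M then u p
     else if p \<in> shift_block M m then v (fst p - M, snd p - M) else c p)"

lemma finite_grid_words [simp]: "finite (grid_words k n)"
  by (auto simp: grid_words_def grid_def intro!: finite_PiE)

lemma card_grid_words: "card (grid_words k n) = k ^ (n^2)"
  by (simp add: grid_words_def grid_def card_PiE power2_eq_square)

lemma card_cross_part: "card (cross_part M m) + M^2 + m^2 = (M + m)^2"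
proof -
  have "grid (M + m) = cross_part M m \<union> (grid M \<union> shift_block M m)"
    by (auto simp: cross_part_def grid_def shift_block_def)
  moreover have "cross_part M m \<inter> (grid M \<union> shift_block M m) = {}"
    by (auto simp: cross_part_def)
  moreover have "grid M \<inter> shift_block M m = {}"
    by (auto simp: grid_def shift_block_def)
  moreover have "finite (grid M)" "finite (shift_block M m)" "finite (cross_part M m)"
    by (auto simp: cross_part_def grid_def shift_block_def)
  ultimately have "card (grid (M + m)) = card (cross_part M m) + (card (grid M) + card (shift_block M m))"
    by (simp add: card_Un_disjoint)
  then show ?thesis
    by (simp add: grid_def shift_block_def power2_eq_square)
qed

lemma join_words_in_grid_words:
  assumes "c \<in> cross_part M m \<rightarrow>\<^sub>E {1..k}" "u \<in> grid_words k M" "v \<in> grid_words k m"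
  shows "join_words M m c u v \<in> grid_words k (M + m)"
  unfolding grid_words_def
proof (rule PiE_I)
  fix p assume p: "p \<in> grid (M + m)"
  consider "p \<in> grid M" | "p \<notin> grid M" "p \<in> shift_block M m"
    | "p \<notin> grid M" "p \<notin> shift_block M m" "p \<in> cross_part M m"
    using p by (auto simp: cross_part_def)
  then show "join_words M m c u v p \<in> {1..k}"
  proof cases
    case 1
    then show ?thesis using assms(2) by (auto simp: join_words_def grid_words_def simp del: atLeastAtMost_iff)
  next
    case 2
    then have "(fst p - M, snd p - M) \<in> grid m"
      by (auto simp: grid_def shift_block_def)
    then have "v (fst p - M, snd p - M) \<in> {1..k}"
      using assms(3) unfolding grid_words_def by blast
    then show ?thesis using 2 by (simp add: join_words_def)
  next
    case 3
    then have "c p \<in> {1..k}" using assms(1) by blast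
    then show ?thesis using 3 by (simp add: join_words_def)
  qed
next
  fix p assume p: "p \<notin> grid (M + m)"
  then have "p \<notin> grid M" "p \<notin> shift_block M m" "p \<notin> cross_part M m"
    by (auto simp: grid_def shift_block_def cross_part_def)
  then show "join_words M m c u v p = undefined"
    using assms(1) by (auto simp: join_words_def)
qed

lemma grid_word_is_join:
  assumes "w \<in> grid_words k (M + m)"
  obtains c u v where "c \<in> cross_part M m \<rightarrow>\<^sub>E {1..k}" "u \<in> grid_words k M" "v \<in> grid_words k m"
    "w = join_words M m c u v"
proof
  have w: "w p \<in> {1..k}" if "p \<in> grid (M + m)" for p
    using assms that unfolding grid_words_def by blast
  show "restrict w (cross_part M m) \<in> cross_part M m \<rightarrow>\<^sub>E {1..k}"
    unfolding restrict_PiE_iff by (intro ballI w) (simp add: cross_part_def)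
  show "restrict w (grid M) \<in> grid_words k M"
    unfolding grid_words_def restrict_PiE_iff by (intro ballI w) (auto simp: grid_def)
  show "(\<lambda>p\<in>grid m. w (fst p + M, snd p + M)) \<in> grid_words k m"
    unfolding grid_words_def restrict_PiE_iff by (intro ballI w) (auto simp: grid_def)
  show "w = join_words M m (restrict w (cross_part M m)) (restrict w (grid M))
      (\<lambda>p\<in>grid m. w (fst p + M, snd p + M))"
  proof
    fix p
    have "(fst p - M, snd p - M) \<in> grid m \<and> (fst p - M + M, snd p - M + M) = p"
      if "p \<in> shift_block M m"
      using that by (auto simp: grid_def shift_block_def)
    moreover have "w p = undefined" if "p \<notin> grid (M + m)"
      using assms that unfolding grid_words_def by (rule PiE_arb)
    ultimately show "w p = join_words M m (restrict w (cross_part M m)) (restrict w (grid M))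
        (\<lambda>p\<in>grid m. w (fst p + M, snd p + M)) p"
      by (auto simp: join_words_def cross_part_def)
  qed
qed

lemma join_words_eq_iff:
  assumes "u \<in> grid_words k M" "u' \<in> grid_words k M" "v \<in> grid_words k m" "v' \<in> grid_words k m"
  shows "join_words M m c u v = join_words M m c u' v' \<longleftrightarrow> u = u' \<and> v = v'"
proof
  assume eq: "join_words M m c u v = join_words M m c u' v'"
  have "u p = u' p" for p
  proof (cases "p \<in> grid M")
    case True
    then show ?thesis using fun_cong[OF eq, of p] by (simp add: join_words_def)
  next
    case False
    then show ?thesis using assms unfolding grid_words_def by (metis PiE_arb)
  qed
  moreover have "v p = v' p" for p
  proof (cases "p \<in> grid m")
    case True
    then have "(fst p + M, snd p + M) \<in> shift_block M m - grid M"
      by (auto simp: grid_def shift_block_def)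
    then show ?thesis using fun_cong[OF eq, of "(fst p + M, snd p + M)"]
      by (simp add: join_words_def)
  next
    case False
    then show ?thesis using assms unfolding grid_words_def by (metis PiE_arb)
  qed
  ultimately show "u = u' \<and> v = v'" by auto
qed simp

section \<open>Letters put into one block\<close>

lemma put_letter_in_grid_words:
  assumes "a \<in> grid_words k n" "x \<in> {1..k}" "\<Gamma> \<subseteq> grid n"
  shows "put_letter a x \<Gamma> \<in> grid_words k n"
  using assms unfolding grid_words_def put_letter_def override_on_def PiE_iff extensional_def
  by auto

lemma join_words_put_letters_left:
  assumes "\<forall>i\<in>{1..d}. \<Gamma> i \<subseteq> grid M"
  shows "join_words M m c (put_letters a x \<Gamma> d) v = put_letters (join_words M m c a v) x \<Gamma> d"
  using assms
proof (induction d)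
  case (Suc d)
  then have IH: "join_words M m c (put_letters a x \<Gamma> d) v = put_letters (join_words M m c a v) x \<Gamma> d"
    by simp
  have push: "join_words M m c (put_letter u y G) v = put_letter (join_words M m c u v) y G"
    if "G \<subseteq> grid M" for u y G
    using that by (auto simp: join_words_def put_letter_def override_on_def fun_eq_iff)
  have "\<Gamma> (Suc d) \<subseteq> grid M" using Suc.prems by simp
  then show ?case by (simp add: push IH)
qed simp

lemma join_words_put_letter_right:
  assumes "\<gamma> \<subseteq> {1..m}"
  shows "join_words M m c u (put_letter b y (\<gamma> \<times> \<gamma>))
    = put_letter (join_words M m c u b) y (((+) M ` \<gamma>) \<times> ((+) M ` \<gamma>))"
proof
  fix p
  have mem: "q - M \<in> \<gamma> \<longleftrightarrow> q \<in> (+) M ` \<gamma>" if "q > M" for q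
    using that by (force simp: image_iff)
  have "((+) M ` \<gamma>) \<times> ((+) M ` \<gamma>) \<subseteq> shift_block M m - grid M"
    using assms by (fastforce simp: shift_block_def grid_def)
  moreover have "(fst p - M, snd p - M) \<in> \<gamma> \<times> \<gamma> \<longleftrightarrow> p \<in> ((+) M ` \<gamma>) \<times> ((+) M ` \<gamma>)"
    if "p \<in> shift_block M m"
    using that mem[of "fst p"] mem[of "snd p"] by (auto simp: shift_block_def)
  ultimately show "join_words M m c u (put_letter b y (\<gamma> \<times> \<gamma>)) p
    = put_letter (join_words M m c u b) y (((+) M ` \<gamma>) \<times> ((+) M ` \<gamma>)) p"
    by (auto simp: join_words_def put_letter_def override_on_def)
qed

lemma put_letters_cong:
  assumes "\<forall>i\<in>{1..d}. x i = x' i" "\<forall>i\<in>{1..d}. \<Gamma> i = \<Gamma>' i"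
  shows "put_letters a x \<Gamma> d = put_letters a x' \<Gamma>' d"
  using assms by (induction d) auto

lemma inj_on_put_letter:
  assumes "\<Gamma> \<noteq> {}"
  shows "inj_on (\<lambda>x. put_letter a x \<Gamma>) X"
proof (rule inj_onI)
  fix x y assume eq: "put_letter a x \<Gamma> = put_letter a y \<Gamma>"
  obtain p where "p \<in> \<Gamma>" using assms by blast
  then show "x = y" using fun_cong[OF eq, of p] by (simp add: put_letter_def)
qed

lemma wildcard_sides_in_grid:
  fixes \<alpha> :: "nat \<Rightarrow> nat set"
  assumes "\<forall>i\<in>{1..d}. \<alpha> i \<subseteq> {1..M}" "\<gamma> \<subseteq> {1..m}"
  shows "\<forall>i\<in>{1..Suc d}. (\<alpha>(Suc d := (+) M ` \<gamma>)) i \<subseteq> {1..M + m}"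
proof
  fix i assume i: "i \<in> {1..Suc d}"
  show "(\<alpha>(Suc d := (+) M ` \<gamma>)) i \<subseteq> {1..M + m}"
  proof (cases "i = Suc d")
    case True
    then show ?thesis using assms(2) by (auto simp: subset_iff)
  next
    case False
    then have "\<alpha> i \<subseteq> {1..M}" using i assms(1) by simp
    also have "\<dots> \<subseteq> {1..M + m}" by simp
    finally show ?thesis using False by simp
  qed
qed

text \<open>
  Joining commutes with putting letters into either block, so the product of a subspace on the first
  block and a line on the second one is again the orbit of a single word, with the wildcard set of
  the line, moved to the second block, as the last one. A joined word determines both of its parts,
  whence the cardinality.
\<close>

lemma comb_subspace_join_line:
  assumes c: "c \<in> cross_part M m \<rightarrow>\<^sub>E {1..k}"
    and \<alpha>: "\<forall>i\<in>{1..d}. \<alpha> i \<subseteq> {1..M}"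
    and S: "is_comb_subspace k M d (\<lambda>i. \<alpha> i \<times> \<alpha> i) S" "S \<subseteq> grid_words k M"
    and \<gamma>: "\<gamma> \<subseteq> {1..m}" "\<gamma> \<noteq> {}"
    and L: "is_comb_line k m (\<gamma> \<times> \<gamma>) L"
    and \<beta>: "\<beta> = \<alpha>(Suc d := (+) M ` \<gamma>)"
    and T: "T = (\<lambda>(u, v). join_words M m c u v) ` (S \<times> L)"
  shows "is_comb_subspace k (M + m) (Suc d) (\<lambda>i. \<beta> i \<times> \<beta> i) T" "card T = card S * k"
proof -
  obtain a where a: "a \<in> grid_words k M"
    and Sa: "S = {put_letters a x (\<lambda>i. \<alpha> i \<times> \<alpha> i) d | x. \<forall>i\<in>{1..d}. x i \<in> {1..k}}"
    using S(1) by (auto simp: is_comb_subspace_def)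
  obtain b where b: "b \<in> grid_words k m"
    and Lb: "L = (\<lambda>y. put_letter b y (\<gamma> \<times> \<gamma>)) ` {1..k}"
    using L unfolding is_comb_line_def by (metis Setcompr_eq_image)
  have \<gamma>_grid: "\<gamma> \<times> \<gamma> \<subseteq> grid m" using \<gamma> by (auto simp: grid_def)
  have L_words: "L \<subseteq> grid_words k m"
    using put_letter_in_grid_words[OF b _ \<gamma>_grid] Lb by blast
  have "card L = k"
    using card_image[OF inj_on_put_letter[of "\<gamma> \<times> \<gamma>" b "{1..k}"]] \<gamma>(2) by (simp add: Lb)
  moreover have "inj_on (\<lambda>(u, v). join_words M m c u v) (S \<times> L)"
  proof (rule inj_onI, clarify)
    fix u v u' v'
    assume *: "u \<in> S" "v \<in> L" "u' \<in> S" "v' \<in> L" "join_words M m c u v = join_words M m c u' v'"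
    then show "u = u' \<and> v = v'"
      using join_words_eq_iff[of u k M u' v m v' c] S(2) L_words by blast
  qed
  ultimately show "card T = card S * k"
    by (simp add: T card_image card_cartesian_product)

  let ?w = "join_words M m c a b"
  have point: "join_words M m c (put_letters a x (\<lambda>i. \<alpha> i \<times> \<alpha> i) d) (put_letter b (x (Suc d)) (\<gamma> \<times> \<gamma>))
      = put_letters ?w x (\<lambda>i. \<beta> i \<times> \<beta> i) (Suc d)" for x
  proof -
    have \<alpha>_grid: "\<forall>i\<in>{1..d}. \<alpha> i \<times> \<alpha> i \<subseteq> grid M" using \<alpha> by (fastforce simp: grid_def)
    have "put_letters ?w x (\<lambda>i. \<alpha> i \<times> \<alpha> i) d = put_letters ?w x (\<lambda>i. \<beta> i \<times> \<beta> i) d"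
      by (rule put_letters_cong) (auto simp: \<beta>)
    then show ?thesis
      by (simp add: join_words_put_letter_right[OF \<gamma>(1)] join_words_put_letters_left[OF \<alpha>_grid] \<beta>)
  qed
  have "T = {put_letters ?w x (\<lambda>i. \<beta> i \<times> \<beta> i) (Suc d) | x. \<forall>i\<in>{1..Suc d}. x i \<in> {1..k}}"
    (is "_ = ?R")
  proof (intro subset_antisym subsetI)
    fix t assume "t \<in> T"
    then obtain x y where x: "\<forall>i\<in>{1..d}. x i \<in> {1..k}" and y: "y \<in> {1..k}"
      and t: "t = join_words M m c (put_letters a x (\<lambda>i. \<alpha> i \<times> \<alpha> i) d) (put_letter b y (\<gamma> \<times> \<gamma>))"
      by (auto simp: T Sa Lb)
    let ?x = "x(Suc d := y)"
    have "put_letters a x (\<lambda>i. \<alpha> i \<times> \<alpha> i) d = put_letters a ?x (\<lambda>i. \<alpha> i \<times> \<alpha> i) d"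
      by (rule put_letters_cong) auto
    then have "t = put_letters ?w ?x (\<lambda>i. \<beta> i \<times> \<beta> i) (Suc d)"
      using t point[of ?x] by simp
    moreover have "\<forall>i\<in>{1..Suc d}. ?x i \<in> {1..k}"
      using x y by (simp add: atLeastAtMostSuc_conv)
    ultimately show "t \<in> ?R" by blast
  next
    fix t assume "t \<in> ?R"
    then obtain x where x: "\<forall>i\<in>{1..Suc d}. x i \<in> {1..k}"
      and t: "t = put_letters ?w x (\<lambda>i. \<beta> i \<times> \<beta> i) (Suc d)" by blast
    have "put_letters a x (\<lambda>i. \<alpha> i \<times> \<alpha> i) d \<in> S" using x by (auto simp: Sa)
    moreover have "put_letter b (x (Suc d)) (\<gamma> \<times> \<gamma>) \<in> L" using x by (auto simp: Lb)
    ultimately show "t \<in> T" unfolding t point[symmetric] T by blast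
  qed
  moreover have "?w \<in> grid_words k (M + m)" by (rule join_words_in_grid_words[OF c a b])
  moreover have "\<forall>i\<in>{1..Suc d}. \<beta> i \<times> \<beta> i \<subseteq> grid (M + m)"
    using wildcard_sides_in_grid[OF \<alpha> \<gamma>(1)] unfolding \<beta> grid_def by blast
  ultimately show "is_comb_subspace k (M + m) (Suc d) (\<lambda>i. \<beta> i \<times> \<beta> i) T"
    unfolding is_comb_subspace_def by blast
qed

section \<open>Density arguments\<close>

text \<open>
  Averaging: every word of \<open>E\<close> is a join for some choice of the cross part, so the sections of \<open>E\<close>
  over the possible cross parts cannot all have density below \<open>\<epsilon>\<close>.
\<close>

lemma dense_join_section:
  assumes E: "E \<subseteq> grid_words k (M + m)" "real (card E) \<ge> \<epsilon> * real k ^ ((M + m)^2)"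
    and "k \<ge> 1"
  obtains c where "c \<in> cross_part M m \<rightarrow>\<^sub>E {1..k}"
    "real (card {(u, v) \<in> grid_words k M \<times> grid_words k m. join_words M m c u v \<in> E})
      \<ge> \<epsilon> * real (card (grid_words k M)) * real (card (grid_words k m))"
proof -
  define C where "C = (cross_part M m \<rightarrow>\<^sub>E {1..k})"
  define P where "P c = {(u, v) \<in> grid_words k M \<times> grid_words k m. join_words M m c u v \<in> E}" for c
  have fin_cross: "finite (cross_part M m)" by (simp add: cross_part_def grid_def)
  then have fin: "finite C" by (simp add: C_def finite_PiE)
  have card_C: "card C = k ^ card (cross_part M m)"
    using fin_cross by (simp add: C_def card_PiE)
  then have "C \<noteq> {}" using \<open>k \<ge> 1\<close> by auto
  have finP: "finite (P c)" for c
    unfolding P_def by (rule finite_subset[of _ "grid_words k M \<times> grid_words k m"]) auto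
  have "E \<subseteq> (\<lambda>(c, u, v). join_words M m c u v) ` Sigma C P"
  proof
    fix w assume "w \<in> E"
    with E(1) obtain c u v where "c \<in> cross_part M m \<rightarrow>\<^sub>E {1..k}" "u \<in> grid_words k M"
      "v \<in> grid_words k m" "w = join_words M m c u v"
      using grid_word_is_join by blast
    with \<open>w \<in> E\<close> show "w \<in> (\<lambda>(c, u, v). join_words M m c u v) ` Sigma C P"
      by (force simp: C_def P_def)
  qed
  then have "card E \<le> card (Sigma C P)"
    by (rule surj_card_le[rotated]) (auto simp: fin finP)
  also have "\<dots> = (\<Sum>c\<in>C. card (P c))" using fin finP by simp
  finally have "real (card E) \<le> real (\<Sum>c\<in>C. card (P c))" by (simp only: of_nat_le_iff)
  then have upper: "\<epsilon> * real k ^ ((M + m)^2) \<le> (\<Sum>c\<in>C. real (card (P c)))"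
    using E(2) by simp
  have total: "\<epsilon> * real k ^ ((M + m)^2)
      = (\<Sum>c\<in>C. \<epsilon> * real (card (grid_words k M)) * real (card (grid_words k m)))"
    by (simp add: card_C card_grid_words power_add card_cross_part[symmetric])
  have "\<exists>c\<in>C. \<epsilon> * real (card (grid_words k M)) * real (card (grid_words k m)) \<le> real (card (P c))"
  proof (rule ccontr)
    assume "\<not> ?thesis"
    then have "(\<Sum>c\<in>C. real (card (P c)))
        < (\<Sum>c\<in>C. \<epsilon> * real (card (grid_words k M)) * real (card (grid_words k m)))"
      by (intro sum_strict_mono fin \<open>C \<noteq> {}\<close>) (simp add: not_le)
    with upper total show False by simp
  qed
  then show ?thesis using that unfolding C_def P_def by blast
qed

text \<open>
  The \<open>y\<close> whose fibre has density below \<open>\<epsilon> / 2\<close> account for at most half of \<open>P\<close>, so the other ones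
  make up a proportion of at least \<open>\<epsilon> / 2\<close> of \<open>Y\<close>. The fibre of each of these contains a member of
  \<open>\<S>\<close>, which is one of only \<open>2 ^ card X\<close> subsets of \<open>X\<close>; the pigeonhole principle does the rest. The
  resulting density depends on \<open>X\<close> but not on \<open>Y\<close>, which allows \<open>Y\<close> to be chosen after \<open>X\<close>.
\<close>

lemma dense_common_subset:
  fixes X :: "'a set" and Y :: "'b set"
  assumes fin: "finite X" "finite Y" and ne: "X \<noteq> {}" "Y \<noteq> {}" and "\<epsilon> > 0"
    and \<S>: "\<And>A. A \<subseteq> X \<Longrightarrow> real (card A) \<ge> \<epsilon> / 2 * real (card X) \<Longrightarrow> \<exists>S\<in>\<S>. S \<subseteq> A"
    and P: "P \<subseteq> X \<times> Y" "real (card P) \<ge> \<epsilon> * real (card X) * real (card Y)"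
  obtains S where "S \<in> \<S>" "S \<subseteq> X"
    "real (card {y \<in> Y. \<forall>x\<in>S. (x, y) \<in> P}) \<ge> \<epsilon> / 2 ^ Suc (card X) * real (card Y)"
proof -
  define A where "A y = {x \<in> X. (x, y) \<in> P}" for y
  define F where "F S = {y \<in> Y. \<forall>x\<in>S. (x, y) \<in> P}" for S
  define G where "G = {y \<in> Y. real (card (A y)) \<ge> \<epsilon> / 2 * real (card X)}"
  define \<T> where "\<T> = \<S> \<inter> Pow X"
  have fin\<T>: "finite \<T>" using fin by (simp add: \<T>_def)
  have X0: "real (card X) > 0" "real (card Y) > 0" using fin ne by (auto simp: card_gt_0_iff)
  have finA: "finite (A y)" "card (A y) \<le> card X" for y
    using fin by (auto simp: A_def intro: card_mono)

  have "card P \<le> card (SIGMA y:Y. A y)"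
    by (rule surj_card_le[where f = "\<lambda>(y, x). (x, y)"]) (use P fin finA in \<open>auto simp: A_def image_iff\<close>)
  also have "\<dots> = (\<Sum>y\<in>Y. card (A y))" using fin finA by simp
  finally have "real (card P) \<le> real (\<Sum>y\<in>Y. card (A y))" by (simp only: of_nat_le_iff)
  also have "\<dots> = (\<Sum>y\<in>Y. real (card (A y)))" by simp
  also have "\<dots> \<le> (\<Sum>y\<in>Y. (if y \<in> G then real (card X) else 0) + \<epsilon> / 2 * real (card X))"
    using \<open>\<epsilon> > 0\<close> finA by (intro sum_mono) (auto simp: G_def add_increasing2)
  also have "\<dots> = real (card G) * real (card X) + real (card Y) * (\<epsilon> / 2 * real (card X))"
  proof -
    have "Y \<inter> G = G" by (auto simp: G_def)
    then show ?thesis using fin by (simp add: sum.distrib sum.If_cases)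
  qed
  finally have "\<epsilon> / 2 * real (card Y) * real (card X) \<le> real (card G) * real (card X)"
    using P(2) by (simp add: algebra_simps)
  then have G: "\<epsilon> / 2 * real (card Y) \<le> real (card G)" using X0 by simp

  have "G \<subseteq> (\<Union>S\<in>\<T>. F S)"
  proof
    fix y assume "y \<in> G"
    then obtain S where "S \<in> \<S>" "S \<subseteq> A y" using \<S>[of "A y"] by (auto simp: G_def A_def)
    with \<open>y \<in> G\<close> show "y \<in> (\<Union>S\<in>\<T>. F S)" by (auto simp: \<T>_def F_def G_def A_def)
  qed
  then have "card G \<le> card (\<Union>S\<in>\<T>. F S)"
    using fin fin\<T> by (intro card_mono) (auto simp: F_def)
  also have "\<dots> \<le> (\<Sum>S\<in>\<T>. card (F S))" by (rule card_UN_le[OF fin\<T>])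
  finally have "real (card G) \<le> real (\<Sum>S\<in>\<T>. card (F S))" by (simp only: of_nat_le_iff)
  then have G_sum: "real (card G) \<le> (\<Sum>S\<in>\<T>. real (card (F S)))" by simp
  have "\<exists>S\<in>\<T>. real (card (F S)) \<ge> \<epsilon> / 2 ^ Suc (card X) * real (card Y)"
  proof (rule ccontr)
    assume "\<not> ?thesis"
    then have small: "real (card (F S)) < \<epsilon> / 2 ^ Suc (card X) * real (card Y)" if "S \<in> \<T>" for S
      using that by force
    have "\<T> \<noteq> {}"
    proof
      assume "\<T> = {}"
      moreover have "\<epsilon> / 2 * real (card Y) > 0" using X0 \<open>\<epsilon> > 0\<close> by simp
      ultimately show False using G G_sum by simp
    qed
    then have "real (card G) < (\<Sum>S\<in>\<T>. \<epsilon> / 2 ^ Suc (card X) * real (card Y))"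
      using small by (intro le_less_trans[OF G_sum] sum_strict_mono fin\<T>)
    also have "\<dots> = real (card \<T>) * (\<epsilon> / 2 ^ Suc (card X) * real (card Y))" by simp
    also have "\<dots> \<le> 2 ^ card X * (\<epsilon> / 2 ^ Suc (card X) * real (card Y))"
    proof (rule mult_right_mono)
      have "card \<T> \<le> card (Pow X)" using fin by (intro card_mono) (auto simp: \<T>_def)
      then show "real (card \<T>) \<le> 2 ^ card X" using fin by (simp add: card_Pow flip: of_nat_le_iff)
    qed (use \<open>\<epsilon> > 0\<close> in auto)
    also have "\<dots> = \<epsilon> / 2 * real (card Y)" by simp
    finally show False using G by simp
  qed
  then show ?thesis using that by (auto simp: \<T>_def F_def)
qed

section \<open>From lines to subspaces\<close>

theorem theorem8:
  fixes k :: nat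
  assumes quadratic_DHJ:
    "\<forall>\<delta>::real. \<delta> > 0 \<longrightarrow> (\<exists>Q::nat. \<forall>n\<ge>Q. \<forall>A. A \<subseteq> grid_words k n \<and> real (card A) \<ge> \<delta> * real k ^ (n^2) \<longrightarrow>
       (\<exists>\<gamma> L. \<gamma> \<subseteq> {1..n} \<and> \<gamma> \<noteq> {} \<and> is_comb_line k n (\<gamma> \<times> \<gamma>) L \<and> L \<subseteq> A))"
  shows "\<forall>\<epsilon>::real. \<epsilon> > 0 \<longrightarrow> (\<forall>d::nat. d \<ge> 1 \<longrightarrow>
       (\<exists>N::nat. N \<ge> 1 \<and> (\<forall>E. E \<subseteq> grid_words k N \<and> real (card E) \<ge> \<epsilon> * real k ^ (N^2) \<longrightarrow>
         (\<exists>\<alpha> S. (\<forall>i\<in>{1..d}. \<alpha> i \<subseteq> {1..N}) \<and> inj_on \<alpha> {1..d} \<and>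
            is_comb_subspace k N d (\<lambda>i. \<alpha> i \<times> \<alpha> i) S \<and> card S = k ^ d \<and> S \<subseteq> E))))"
proof -
  have k: "k \<ge> 1"
  proof (rule ccontr)
    \<comment> \<open>Over the empty alphabet a nonempty grid carries no words, so it has no line, although the
      empty set satisfies the density condition.\<close>
    assume "\<not> k \<ge> 1"
    then have "k = 0" by simp
    obtain Q where "\<forall>n\<ge>Q. \<forall>A. A \<subseteq> grid_words k n \<and> real (card A) \<ge> 1 * real k ^ (n^2) \<longrightarrow>
       (\<exists>\<gamma> L. \<gamma> \<subseteq> {1..n} \<and> \<gamma> \<noteq> {} \<and> is_comb_line k n (\<gamma> \<times> \<gamma>) L \<and> L \<subseteq> A)"
      using quadratic_DHJ zero_less_one by blast
    from this[rule_format, of "Suc Q" "{}"] obtain \<gamma> L where "is_comb_line k (Suc Q) (\<gamma> \<times> \<gamma>) L"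
      using \<open>k = 0\<close> by (auto simp: power2_eq_square)
    then obtain a where "a \<in> grid_words k (Suc Q)" by (auto simp: is_comb_line_def)
    moreover have "(1, 1) \<in> grid (Suc Q)" by (simp add: grid_def)
    ultimately show False using \<open>k = 0\<close> by (auto simp: grid_words_def)
  qed
  \<comment> \<open>The claim itself serves as the induction hypothesis: each step adds a set that is not contained in
    \<open>{1..M}\<close>, and the cardinality is multiplicative. The induction starts at dimension \<open>0\<close>, where a
    single word is a subspace.\<close>
  define sub where "sub d N \<alpha> S \<longleftrightarrow> (\<forall>i\<in>{1..d}. \<alpha> i \<subseteq> {1..N}) \<and> inj_on \<alpha> {1..d} \<and>
    is_comb_subspace k N d (\<lambda>i. \<alpha> i \<times> \<alpha> i) S \<and> card S = k ^ d" for d N \<alpha> S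
  have subspace: "\<exists>N\<ge>1. \<forall>E. E \<subseteq> grid_words k N \<and> real (card E) \<ge> \<epsilon> * real k ^ (N^2) \<longrightarrow>
      (\<exists>\<alpha> S. sub d N \<alpha> S \<and> S \<subseteq> E)" if "\<epsilon> > 0" for \<epsilon> :: real and d
    using that
  proof (induction d arbitrary: \<epsilon>)
    case 0
    show ?case
    proof (intro exI[of _ 1] conjI allI impI)
      fix E assume E: "E \<subseteq> grid_words k 1 \<and> \<epsilon> * real k ^ 1\<^sup>2 \<le> real (card E)"
      then have "\<epsilon> * real k \<le> real (card E)" by simp
      moreover have "\<epsilon> * real k > 0" using 0 k by simp
      ultimately have "real (card E) > 0" by linarith
      then have "card E \<noteq> 0" by simp
      then obtain a where "a \<in> E" by (metis card.empty ex_in_conv)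
      with E have "sub 0 1 (\<lambda>_. {}) {a}" by (auto simp: sub_def is_comb_subspace_def)
      with \<open>a \<in> E\<close> show "\<exists>\<alpha> S. sub 0 1 \<alpha> S \<and> S \<subseteq> E" by blast
    qed simp
  next
    case (Suc d)
    have "\<epsilon> / 2 > 0" using Suc.prems by simp
    from Suc.IH[OF this] obtain M where M: "M \<ge> 1"
      and IH: "\<forall>A. A \<subseteq> grid_words k M \<and> real (card A) \<ge> \<epsilon> / 2 * real k ^ (M^2) \<longrightarrow>
        (\<exists>\<alpha> S. sub d M \<alpha> S \<and> S \<subseteq> A)"
      by (elim exE conjE)
    \<comment> \<open>The density that \<open>dense_common_subset\<close> leaves on the second block; it must be known before the
      side \<open>m\<close> of that block can be chosen.\<close>
    define \<delta> where "\<delta> = \<epsilon> / 2 ^ Suc (card (grid_words k M))"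
    have "\<delta> > 0" using Suc.prems by (simp add: \<delta>_def)
    with quadratic_DHJ obtain m where
      "\<forall>n\<ge>m. \<forall>A. A \<subseteq> grid_words k n \<and> real (card A) \<ge> \<delta> * real k ^ (n^2) \<longrightarrow>
       (\<exists>\<gamma> L. \<gamma> \<subseteq> {1..n} \<and> \<gamma> \<noteq> {} \<and> is_comb_line k n (\<gamma> \<times> \<gamma>) L \<and> L \<subseteq> A)"
      by (elim allE[of _ \<delta>] impE exE)
    note m = this[rule_format, OF order.refl, OF conjI]
    have words_ne: "grid_words k n \<noteq> {}" for n
      using k card_grid_words[of k n] by auto
    show ?case
    proof (intro exI[of _ "M + m"] conjI allI impI)
      fix E assume E: "E \<subseteq> grid_words k (M + m) \<and> \<epsilon> * real k ^ (M + m)\<^sup>2 \<le> real (card E)"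
      obtain c where c: "c \<in> cross_part M m \<rightarrow>\<^sub>E {1..k}" and dense:
        "real (card {(u, v) \<in> grid_words k M \<times> grid_words k m. join_words M m c u v \<in> E})
          \<ge> \<epsilon> * real (card (grid_words k M)) * real (card (grid_words k m))"
        by (rule dense_join_section[OF conjunct1[OF E] conjunct2[OF E] k])
      let ?P = "{(u, v) \<in> grid_words k M \<times> grid_words k m. join_words M m c u v \<in> E}"
      have ex: "\<exists>S\<in>{S. \<exists>\<alpha>. sub d M \<alpha> S}. S \<subseteq> A"
        if "A \<subseteq> grid_words k M" "real (card A) \<ge> \<epsilon> / 2 * real (card (grid_words k M))" for A
      proof -
        have "real (card A) \<ge> \<epsilon> / 2 * real k ^ (M^2)" using that(2) by (simp add: card_grid_words)
        with that(1) obtain \<alpha> S where "sub d M \<alpha> S" "S \<subseteq> A" using IH[rule_format, of A] by auto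
        then show ?thesis by auto
      qed
      obtain S where S: "S \<in> {S. \<exists>\<alpha>. sub d M \<alpha> S}" "S \<subseteq> grid_words k M" and
        F: "real (card {v \<in> grid_words k m. \<forall>u\<in>S. (u, v) \<in> ?P}) \<ge> \<delta> * real (card (grid_words k m))"
        unfolding \<delta>_def
        by (rule dense_common_subset[OF finite_grid_words finite_grid_words words_ne words_ne
              Suc.prems ex _ dense]) auto
      from S(1) obtain \<alpha> where "sub d M \<alpha> S" by auto
      then have \<alpha>: "\<forall>i\<in>{1..d}. \<alpha> i \<subseteq> {1..M}" "inj_on \<alpha> {1..d}"
        "is_comb_subspace k M d (\<lambda>i. \<alpha> i \<times> \<alpha> i) S" "card S = k ^ d"
        unfolding sub_def by simp_all
      let ?F = "{v \<in> grid_words k m. \<forall>u\<in>S. (u, v) \<in> ?P}"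
      have "?F \<subseteq> grid_words k m" by (rule Collect_restrict)
      moreover have "real (card ?F) \<ge> \<delta> * real k ^ (m^2)"
        using F by (simp only: card_grid_words of_nat_power)
      ultimately obtain \<gamma> L where \<gamma>: "\<gamma> \<subseteq> {1..m}" "\<gamma> \<noteq> {}"
        and L: "is_comb_line k m (\<gamma> \<times> \<gamma>) L" "L \<subseteq> ?F"
        using m[of ?F] by (elim meta_impE exE conjE)
      define \<beta> where "\<beta> = \<alpha>(Suc d := (+) M ` \<gamma>)"
      define T where "T = (\<lambda>(u, v). join_words M m c u v) ` (S \<times> L)"
      note T = comb_subspace_join_line[OF c \<alpha>(1,3) S(2) \<gamma> L(1) \<beta>_def T_def]
      have "\<forall>i\<in>{1..Suc d}. \<beta> i \<subseteq> {1..M + m}"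
        using wildcard_sides_in_grid[OF \<alpha>(1) \<gamma>(1)] by (simp only: \<beta>_def)
      moreover have "inj_on \<beta> {1..Suc d}"
      proof -
        obtain g where g: "g \<in> \<gamma>" "g \<in> {1..m}" using \<gamma> by blast
        then have "M + g \<in> (+) M ` \<gamma>" "M + g \<notin> {1..M}" by auto
        then have "(+) M ` \<gamma> \<notin> \<alpha> ` {1..d}" using \<alpha>(1) by blast
        moreover have "\<beta> ` {1..d} = \<alpha> ` {1..d}" by (rule image_cong) (simp_all add: \<beta>_def)
        moreover have "\<beta> (Suc d) = (+) M ` \<gamma>" by (simp add: \<beta>_def)
        ultimately have "\<beta> (Suc d) \<notin> \<beta> ` {1..d}" by simp
        moreover have "inj_on \<beta> {1..d}"
          using \<alpha>(2) by (subst inj_on_cong[of _ \<beta> \<alpha>]) (simp_all add: \<beta>_def)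
        moreover have "{1..Suc d} = insert (Suc d) {1..d}" "{1..d} - {Suc d} = {1..d}" by auto
        ultimately show ?thesis by (simp only: inj_on_insert not_False_eq_True simp_thms)
      qed
      moreover have "card T = k ^ Suc d" using T(2) \<alpha>(4) by simp
      moreover have "T \<subseteq> E" using L(2) by (auto simp: T_def)
      ultimately have "sub (Suc d) (M + m) \<beta> T" "T \<subseteq> E" using T(1) by (simp_all only: sub_def)
      then show "\<exists>\<alpha> S. sub (Suc d) (M + m) \<alpha> S \<and> S \<subseteq> E" by (intro exI conjI)
    qed (use M in simp)
  qed
  show ?thesis
  proof (intro allI impI)
    fix \<epsilon> :: real and d :: nat
    assume "\<epsilon> > 0"
    from subspace[OF this, of d, unfolded sub_def conj_assoc]
    show "\<exists>N\<ge>1. \<forall>E. E \<subseteq> grid_words k N \<and> real (card E) \<ge> \<epsilon> * real k ^ (N^2) \<longrightarrow>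
         (\<exists>\<alpha> S. (\<forall>i\<in>{1..d}. \<alpha> i \<subseteq> {1..N}) \<and> inj_on \<alpha> {1..d} \<and>
            is_comb_subspace k N d (\<lambda>i. \<alpha> i \<times> \<alpha> i) S \<and> card S = k ^ d \<and> S \<subseteq> E)" .
  qed
qed

end
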